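(* Let $a,b\in\mathbb{C}$ and $c\in\mathbb{R}$ satisfy $|a|^2+|b|^2+|c|^2=1$, and let $$A=\begin{bmatrix}1&0&a\\0&-1&b\\0&0&c\,\mathrm{i}\end{bmatrix},$$ where $\mathrm{i}$ is the imaginary unit. Set $X_0=A$ and let $X_1,X_2,\dots$ be a sequence of complex $3\times 3$ matrices such that, for every $k\ge 0$, $X_{k+1}$ is an eigenvector matrix of $X_k$ satisfying the constraint that it is of the form $$X_{k+1}=\begin{bmatrix}1&0&x\\0&-1&y\\0&0&z\,\mathrm{i}\end{bmatrix},\qquad x,y\in\mathbb{C},\quad z\in\mathbb{R},\quad |x|^2+|y|^2+|z|^2=1$$ (with $x,y,z$ depending on $k$). Then, in the limit of repeatedly taking eigenvectors, $$\lim_{k\to\infty}X_k=\begin{bmatrix}1&0&0\\0&-1&0\\0&0&\mathrm{i}\end{bmatrix}.$$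
   Context: An eigenvector matrix of an $n\times n$ matrix $M$ is an invertible $n\times n$ matrix $X$ whose columns are eigenvectors of $M$, each of unit Euclidean ($\mathcal L_2$) norm.
   Formalization: The added hypothesis is that z ≥ 0 in X_k for all sufficiently large k; without it the claim fails, e.g. a=b=0, c=1, X_k=diag(1,-1,-i) for all k≥1, since the constraint fixes the third column only up to sign. *)

theory Defs
  imports "HOL-Analysis.Analysis"
begin

definition is_eigenvector :: "complex^'n^'n \<Rightarrow> complex^'n \<Rightarrow> bool" where
  "is_eigenvector M v \<longleftrightarrow> v \<noteq> 0 \<and> (\<exists>\<mu>. M *v v = \<mu> *s v)"

text \<open>The norm of type \<open>complex^'n\<close> is the Euclidean one.\<close>

definition eigenvector_matrix :: "complex^'n^'n \<Rightarrow> complex^'n^'n \<Rightarrow> bool" where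
  "eigenvector_matrix M X \<longleftrightarrow>
     invertible X \<and> (\<forall>j. is_eigenvector M (column j X) \<and> norm (column j X) = 1)"

definition constrained_form :: "complex \<Rightarrow> complex \<Rightarrow> real \<Rightarrow> complex^3^3" where
  "constrained_form x y z =
     vector [vector [1,  0, x],
             vector [0, -1, y],
             vector [0,  0, complex_of_real z * \<i>]]"

text \<open>
  An eigenvector matrix of constrained form is determined only up to the sign of its third
  column: if \<open>constrained_form x y z\<close> is one, so is \<open>constrained_form (-x) (-y) (-z)\<close>.
  For example, \<open>constrained_form 0 0 (-1)\<close> is an eigenvector matrix both of
  \<open>constrained_form 0 0 1\<close> and of itself. Convergence to \<open>constrained_form 0 0 1\<close>
  therefore needs a choice of sign; the weakest that suffices is that the last diagonal
  entry \<open>z * \<i>\<close> eventually has \<open>z \<ge> 0\<close>.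
\<close>

end

theory Submission
  imports Defs
begin

text \<open>
  The third column of an eigenvector matrix of \<open>constrained_form a b c\<close> belongs to the
  eigenvalue \<open>c * \<i>\<close>, which determines it up to scaling; with the normalisation this gives
  \<open>1 - z\<^sup>2 = (1 - c\<^sup>2) / 2\<close>. So \<open>1 - z\<^sup>2\<close>, which is also the squared norm of the entries above
  the diagonal, is halved at every step.
\<close>

lemma constrained_form_nth [simp]:
  "constrained_form x y z $ 1 = vector [1, 0, x]"
  "constrained_form x y z $ 2 = vector [0, -1, y]"
  "constrained_form x y z $ 3 = vector [0, 0, complex_of_real z * \<i>]"
  by (simp_all add: constrained_form_def)

text \<open>Turns invertibility into \<open>z \<noteq> 0\<close>, which is what lets the third row
  fix the eigenvalue.\<close>

lemma det_constrained_form: "det (constrained_form x y z) = - (complex_of_real z * \<i>)"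
  by (simp add: det_3)

lemma tendsto_constrained_form:
  assumes "(x \<longlongrightarrow> x') F" "(y \<longlongrightarrow> y') F" "(z \<longlongrightarrow> z') F"
  shows "((\<lambda>k. constrained_form (x k) (y k) (z k)) \<longlongrightarrow> constrained_form x' y' z') F"
proof (intro vec_tendstoI)
  fix i j :: 3
  show "((\<lambda>k. constrained_form (x k) (y k) (z k) $ i $ j) \<longlongrightarrow> constrained_form x' y' z' $ i $ j) F"
    using exhaust_3[of i] exhaust_3[of j] assms
    by (auto intro!: tendsto_mult tendsto_of_real)
qed

text \<open>With the eigenvalue \<open>c * \<i>\<close> known, each of the first two rows is a
  linear equation in a single unknown, \<open>x\<close> or \<open>y\<close>. Taking squared moduli
  discards the phases, which the normalisation does not see.\<close>

lemma eigenvector_third_column: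
  assumes "is_eigenvector (constrained_form a b c) (column 3 (constrained_form x y z))"
    and "z \<noteq> 0"
  shows "(cmod x)\<^sup>2 * (1 + c\<^sup>2) = (cmod a)\<^sup>2 * z\<^sup>2" "(cmod y)\<^sup>2 * (1 + c\<^sup>2) = (cmod b)\<^sup>2 * z\<^sup>2"
proof -
  from assms(1) obtain \<mu> where
    eq: "constrained_form a b c *v column 3 (constrained_form x y z)
           = \<mu> *s column 3 (constrained_form x y z)"
    by (auto simp: is_eigenvector_def)
  have row: "(constrained_form a b c *v column 3 (constrained_form x y z)) $ i
               = (\<mu> *s column 3 (constrained_form x y z)) $ i" for i
    by (simp only: eq)
  \<comment> \<open>The third row reads \<open>c * \<i> * (z * \<i>) = \<mu> * (z * \<i>)\<close>,
    and the nonzero factor cancels.\<close>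
  have 3: "\<mu> = complex_of_real c * \<i>"
    using row[of 3] \<open>z \<noteq> 0\<close> by (simp add: matrix_vector_mult_def column_def sum_3)
  have 1: "x * (1 - complex_of_real c * \<i>) = - (a * (complex_of_real z * \<i>))"
    using row[of 1] by (simp add: matrix_vector_mult_def column_def sum_3 3 algebra_simps)
  have 2: "y * (1 + complex_of_real c * \<i>) = b * (complex_of_real z * \<i>)"
    using row[of 2] by (simp add: matrix_vector_mult_def column_def sum_3 3 algebra_simps)
  \<comment> \<open>Up to sign, these are the gaps between the eigenvalues \<open>1\<close>,
    \<open>-1\<close> and \<open>c * \<i>\<close>. As \<open>c\<close> is real, both have the same
    modulus, so the two rows can later be added.\<close>
  have n: "(cmod (1 - complex_of_real c * \<i>))\<^sup>2 = 1 + c\<^sup>2" "(cmod (1 + complex_of_real c * \<i>))\<^sup>2 = 1 + c\<^sup>2"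
    by (simp_all add: cmod_power2)
  show "(cmod x)\<^sup>2 * (1 + c\<^sup>2) = (cmod a)\<^sup>2 * z\<^sup>2"
    using arg_cong[OF 1, of "\<lambda>u. (cmod u)\<^sup>2"] by (simp add: norm_mult power_mult_distrib n)
  show "(cmod y)\<^sup>2 * (1 + c\<^sup>2) = (cmod b)\<^sup>2 * z\<^sup>2"
    using arg_cong[OF 2, of "\<lambda>u. (cmod u)\<^sup>2"] by (simp add: norm_mult power_mult_distrib n)
qed

lemma eigenvector_matrix_constrained_form_halves:
  assumes "eigenvector_matrix (constrained_form a b c) (constrained_form x y z)"
    and abc: "(cmod a)\<^sup>2 + (cmod b)\<^sup>2 + c\<^sup>2 = 1"
    and xyz: "(cmod x)\<^sup>2 + (cmod y)\<^sup>2 + z\<^sup>2 = 1"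
  shows "1 - z\<^sup>2 = (1 - c\<^sup>2) / 2"
proof -
  have "z \<noteq> 0"
    using assms(1) by (auto simp: eigenvector_matrix_def invertible_det_nz det_constrained_form)
  moreover have "is_eigenvector (constrained_form a b c) (column 3 (constrained_form x y z))"
    using assms(1) by (auto simp: eigenvector_matrix_def)
  ultimately have "((cmod x)\<^sup>2 + (cmod y)\<^sup>2) * (1 + c\<^sup>2) = ((cmod a)\<^sup>2 + (cmod b)\<^sup>2) * z\<^sup>2"
    by (simp add: eigenvector_third_column distrib_right)
  moreover have "(cmod x)\<^sup>2 + (cmod y)\<^sup>2 = 1 - z\<^sup>2" "(cmod a)\<^sup>2 + (cmod b)\<^sup>2 = 1 - c\<^sup>2"
    using abc xyz by simp_all
  ultimately have "(1 - z\<^sup>2) * (1 + c\<^sup>2) = (1 - c\<^sup>2) * z\<^sup>2"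
    by simp
  \<comment> \<open>The products of \<open>c\<close> squared and \<open>z\<close> squared cancel,
    leaving \<open>1 + c^2 = 2 * z^2\<close>.\<close>
  then show ?thesis
    by (simp add: algebra_simps)
qed

theorem theorem3p3:
  fixes a b :: complex and c :: real and X :: "nat \<Rightarrow> complex^3^3"
  assumes "(cmod a)\<^sup>2 + (cmod b)\<^sup>2 + \<bar>c\<bar>\<^sup>2 = 1"
    and "X 0 = constrained_form a b c"
    and "\<And>k. eigenvector_matrix (X k) (X (Suc k))"
    and "\<And>k. \<exists>x y z. X (Suc k) = constrained_form x y z \<and>
                  (cmod x)\<^sup>2 + (cmod y)\<^sup>2 + \<bar>z\<bar>\<^sup>2 = 1"
    and sign: "\<forall>\<^sub>F k in sequentially. 0 \<le> Im (X k $ 3 $ 3)"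
  shows "X \<longlonglongrightarrow> constrained_form 0 0 1"
proof -
  \<comment> \<open>The initial matrix obeys the same normalisation as its successors, so one
    parametrisation covers all indices and the halving starts at \<open>k = 0\<close>.\<close>
  have "\<exists>x y z. X k = constrained_form x y z \<and> (cmod x)\<^sup>2 + (cmod y)\<^sup>2 + z\<^sup>2 = 1" for k
    using assms(1,2,4) by (cases k) auto
  then obtain x y z where X: "\<And>k. X k = constrained_form (x k) (y k) (z k)"
    and unit: "\<And>k. (cmod (x k))\<^sup>2 + (cmod (y k))\<^sup>2 + (z k)\<^sup>2 = 1"
    by metis
  have halves: "1 - (z (Suc k))\<^sup>2 = (1 - (z k)\<^sup>2) / 2" for k
    using eigenvector_matrix_constrained_form_halves assms(3)[of k] unit unfolding X by blast
  define d where "d = 1 - (z 0)\<^sup>2"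
  have "1 - (z k)\<^sup>2 = d * (1/2) ^ k" for k
    by (induction k) (simp_all add: halves d_def)
  moreover have "(\<lambda>k. d * (1/2) ^ k) \<longlonglongrightarrow> 0"
    by (intro tendsto_mult_right_zero LIMSEQ_power_zero) simp
  ultimately have lim: "(\<lambda>k. 1 - (z k)\<^sup>2) \<longlonglongrightarrow> 0"
    by simp
  have small: "(cmod (x k))\<^sup>2 \<le> 1 - (z k)\<^sup>2" "(cmod (y k))\<^sup>2 \<le> 1 - (z k)\<^sup>2" for k
    using unit[of k] zero_le_power2[of "cmod (x k)"] zero_le_power2[of "cmod (y k)"] by linarith+
  \<comment> \<open>Stated for a generic \<open>w\<close> to serve both \<open>x\<close> and
    \<open>y\<close>: a squeeze between \<open>0\<close> and the vanishing defect.\<close>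
  have to_zero: "w \<longlonglongrightarrow> 0" if "\<And>k. (cmod (w k))\<^sup>2 \<le> 1 - (z k)\<^sup>2" for w :: "nat \<Rightarrow> complex"
  proof -
    have "(\<lambda>k. (cmod (w k))\<^sup>2) \<longlonglongrightarrow> 0"
      by (rule tendsto_sandwich[OF _ _ tendsto_const lim]) (use that in auto)
    then show ?thesis
      by (simp add: tendsto_norm_zero_iff)
  qed
  \<comment> \<open>The defect only controls the square of \<open>z\<close>, so the root yields the
    limit of the absolute value. The double subtraction lets \<open>lim\<close> apply
    directly.\<close>
  have "(\<lambda>k. sqrt (1 - (1 - (z k)\<^sup>2))) \<longlonglongrightarrow> sqrt (1 - 0)"
    by (intro tendsto_intros lim)
  then have "(\<lambda>k. \<bar>z k\<bar>) \<longlonglongrightarrow> 1"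
    by simp
  \<comment> \<open>The sign choice enters here: the last diagonal entry is
    \<open>z k * \<i>\<close>, whose imaginary part is \<open>z k\<close>.\<close>
  moreover have "\<forall>\<^sub>F k in sequentially. \<bar>z k\<bar> = z k"
    using sign by (auto simp: X elim: eventually_mono)
  ultimately have "z \<longlonglongrightarrow> 1"
    by (rule Lim_transform_eventually)
  then have "(\<lambda>k. constrained_form (x k) (y k) (z k)) \<longlonglongrightarrow> constrained_form 0 0 1"
    by (intro tendsto_constrained_form to_zero small)
  moreover have "X = (\<lambda>k. constrained_form (x k) (y k) (z k))"
    using X by blast
  ultimately show ?thesis
    by simp
qed

end
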